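(* Let $d\ge 1$ be an integer and $\sigma>0$. The Fourier transform of the function $f_\sigma\colon\mathbb{R}\to\mathbb{R}$, $f_\sigma(x)={_1}F_1\big(\tfrac d2;\tfrac12;\tfrac{-x^2}{2\sigma^2}\big)$, is given by $$\hat f_\sigma(\omega)=\int_{\mathbb{R}} f_\sigma(x)\exp(-2\pi i x\omega)\,\mathrm{d}x=\frac{d\,\pi\,\sigma\,\exp(-2\pi^2\sigma^2\omega^2)\,(2\pi^2\sigma^2\omega^2)^{(d-1)/2}}{\sqrt{2}\,\Gamma\big(\frac{d+2}{2}\big)},\qquad \omega\in\mathbb{R}.$$
   Context: ${_1}F_1$ is the confluent hypergeometric function ${_1}F_1(a;b;z)=\sum_{n=0}^\infty\frac{\Gamma(a+n)\Gamma(b)}{\Gamma(a)\Gamma(b+n)}\frac{z^n}{n!}$. For $d=1$ and $\omega=0$ the convention $0^0=1$ is used. *)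

theory Defs
  imports "HOL-Analysis.Analysis"
begin

definition hyp1F1 :: "real \<Rightarrow> real \<Rightarrow> real \<Rightarrow> real" where
  "hyp1F1 a b z =
     (\<Sum>n. Gamma (a + real n) * Gamma b / (Gamma a * Gamma (b + real n)) * (z ^ n / fact n))"

definition fourier_transform :: "(real \<Rightarrow> real) \<Rightarrow> real \<Rightarrow> complex" where
  "fourier_transform f \<omega> =
     (LINT x|lborel. complex_of_real (f x) * exp (- 2 * complex_of_real pi * \<i> * complex_of_real x * complex_of_real \<omega>))"

definition f_sigma :: "nat \<Rightarrow> real \<Rightarrow> real \<Rightarrow> real" where
  "f_sigma d \<sigma> x = hyp1F1 (real d / 2) (1 / 2) (- (x\<^sup>2) / (2 * \<sigma>\<^sup>2))"

(* Real power of a nonnegative base with 0^0 = 1; the library has 0 powr 0 = 0. *)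
definition pow0 :: "real \<Rightarrow> real \<Rightarrow> real" where
  "pow0 x a = (if x = 0 \<and> a = 0 then 1 else x powr a)"

end

theory Submission
  imports Defs "HOL-Probability.Characteristic_Functions" "HOL-Probability.Sinc_Integral" "HOL-Real_Asymp.Real_Asymp"
begin

text \<open>
  Write \<open>n = d - 1\<close> and \<open>p(u) = \<bar>u\<bar>\<^sup>n exp(-u\<^sup>2)\<close>. Integrating the cosine series term by term
  against \<open>p\<close> shows that the characteristic function of \<open>p\<close> at \<open>y\<close> is
  \<open>\<Gamma>(d/2) \<^sub>1F\<^sub>1(d/2; 1/2; -y\<^sup>2/4)\<close>. So the theorem is Fourier inversion for \<open>p\<close>, up to the
  rescaling \<open>y = \<surd>2 x / \<sigma>\<close>. Inversion needs the characteristic function to be integrable; for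
  even \<open>d\<close> the density \<open>p\<close> is not smooth at \<open>0\<close>, but on the half-line two integrations by parts
  still give decay \<open>O(y\<^sup>-\<^sup>2)\<close>, because the boundary term of order \<open>1/y\<close> carries a factor \<open>sin 0\<close>.
\<close>

subsection \<open>Fourier inversion\<close>

lemma std_normal_iexp_integral:
  "(CLINT y|lborel. complex_of_real (std_normal_density y) * iexp (t * y)) = exp (- (t\<^sup>2 / 2))"
proof -
  have "char std_normal_distribution t = (CLINT y|lborel. std_normal_density y *\<^sub>R iexp (t * y))"
    unfolding char_def by (rule integral_density) (auto simp: normal_density_nonneg)
  then show ?thesis
    by (simp add: char_std_normal_distribution scaleR_conv_of_real flip: exp_of_real)
qed

lemma integrable_std_normal: "integrable lborel std_normal_density"
  using integrable_std_normal_moment[of 0] by simp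

lemma integrable_mult_iexp:
  fixes p :: "real \<Rightarrow> complex"
  assumes "integrable lborel p"
  shows "integrable lborel (\<lambda>u. p u * iexp (y * u))"
proof (rule Bochner_Integration.integrable_bound[OF assms])
  show "(\<lambda>u. p u * iexp (y * u)) \<in> borel_measurable lborel"
    using borel_measurable_integrable[OF assms] by measurable
qed (simp add: norm_mult)

text \<open>The Gaussian factor makes the double integral absolutely convergent, so that Fubini applies.\<close>

lemma fourier_gauss_regularised:
  fixes p :: "real \<Rightarrow> complex" and e v :: real
  assumes p: "integrable lborel p" and e: "e > 0"
  shows "(CLINT y|lborel. std_normal_density (e * y) *\<^sub>R
            ((CLINT u|lborel. p u * iexp (y * u)) * iexp (- (y * v))))
       = (CLINT w|lborel. exp (- (w\<^sup>2 / 2)) *\<^sub>R p (v + e * w))"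
proof -
  have [measurable]: "p \<in> borel_measurable borel"
    using borel_measurable_integrable[OF p] by simp
  define F where "F = (\<lambda>u y. std_normal_density (e * y) *\<^sub>R (p u * iexp (y * (u - v))))"
  have nF: "norm (F u y) = std_normal_density (e * y) * norm (p u)" for u y
    by (simp add: F_def norm_mult normal_density_nonneg del: of_real_mult of_real_diff)
  have N: "integrable lborel (\<lambda>y. std_normal_density (e * y))"
    using lborel_integrable_real_affine[OF integrable_std_normal, of e 0] e by simp
  have F_int: "integrable (lborel \<Otimes>\<^sub>M lborel) (case_prod F)"
  proof (rule lborel_pair.Fubini_integrable)
    show "case_prod F \<in> borel_measurable (lborel \<Otimes>\<^sub>M lborel)"
      unfolding F_def normal_density_def by measurable
    show "integrable lborel (\<lambda>x. \<integral>y. norm (case_prod F (x, y)) \<partial>lborel)"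
      using p by (simp add: nF)
    have "integrable lborel (F u)" for u
    proof (rule Bochner_Integration.integrable_bound)
      show "integrable lborel (\<lambda>y. std_normal_density (e * y) * norm (p u))"
        using N by simp
      show "F u \<in> borel_measurable lborel"
        unfolding F_def normal_density_def by measurable
    qed (simp add: nF normal_density_nonneg)
    then show "AE x in lborel. integrable lborel (\<lambda>y. case_prod F (x, y))" by simp
  qed
  \<comment> \<open>With \<open>z = e * y\<close> the inner integral becomes the characteristic
    function of the standard normal distribution at \<open>(u - v) / e\<close>; the substitution
    costs a factor \<open>1 / e\<close>.\<close>
  have inner: "(CLINT y|lborel. F u y) = (1 / e) *\<^sub>R (exp (- (((u - v) / e)\<^sup>2 / 2)) *\<^sub>R p u)" for u
  proof -
    have "(CLINT y|lborel. F u y) = \<bar>1 / e\<bar> *\<^sub>R (CLINT z|lborel. F u (0 + 1 / e * z))"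
      using e by (intro lborel_integral_real_affine) simp
    also have "(CLINT z|lborel. F u (0 + 1 / e * z))
        = (CLINT z|lborel. p u * (complex_of_real (std_normal_density z) * iexp ((u - v) / e * z)))"
      using e by (intro Bochner_Integration.integral_cong)
        (simp_all add: F_def scaleR_conv_of_real mult_ac)
    also have "\<dots> = p u * exp (- (((u - v) / e)\<^sup>2 / 2))"
      by (subst integral_mult_right_zero, subst std_normal_iexp_integral) simp
    finally show ?thesis
      using e by (simp add: scaleR_conv_of_real mult_ac)
  qed
  have "(CLINT y|lborel. std_normal_density (e * y) *\<^sub>R
            ((CLINT u|lborel. p u * iexp (y * u)) * iexp (- (y * v))))
      = (CLINT y|lborel. CLINT u|lborel. F u y)"
  proof (rule Bochner_Integration.integral_cong[OF refl])
    fix y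
    have "F u y = (std_normal_density (e * y) *\<^sub>R iexp (- (y * v))) * (p u * iexp (y * u))" for u
      by (simp add: F_def scaleR_conv_of_real mult_ac right_diff_distrib exp_diff exp_minus divide_inverse)
    then show "std_normal_density (e * y) *\<^sub>R ((CLINT u|lborel. p u * iexp (y * u)) * iexp (- (y * v)))
        = (CLINT u|lborel. F u y)"
      by (simp only: integral_mult_right_zero) (simp add: scaleR_conv_of_real mult_ac)
  qed
  also have "\<dots> = (CLINT u|lborel. CLINT y|lborel. F u y)"
    by (rule lborel_pair.Fubini_integral[OF F_int])
  \<comment> \<open>The substitution \<open>u = v + e * w\<close> absorbs the factor
    \<open>1 / e\<close> and frees the Gaussian weight from \<open>e\<close> and
    \<open>v\<close>.\<close>
  also have "\<dots> = \<bar>e\<bar> *\<^sub>R (CLINT w|lborel. CLINT y|lborel. F (v + e * w) y)"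
    using e by (intro lborel_integral_real_affine) simp
  also have "\<dots> = (CLINT w|lborel. exp (- (w\<^sup>2 / 2)) *\<^sub>R p (v + e * w))"
    unfolding inner integral_scaleR_right using e by simp
  finally show ?thesis .
qed

text \<open>Let \<open>e\<close> tend to 0 in the regularised identity. Integrability of the
  transform dominates the left side; \<open>B\<close> times a Gaussian dominates the right side,
  whose pointwise limit is continuity of \<open>p\<close> at \<open>v\<close>. The density at 0 is
  \<open>1 / sqrt (2 * pi)\<close> and the Gaussian mass is \<open>sqrt (2 * pi)\<close>, which
  together give the factor \<open>2 * pi\<close>.\<close>

lemma fourier_inversion_continuous:
  fixes p :: "real \<Rightarrow> complex" and v :: real
  assumes cont: "continuous_on UNIV p" and p: "integrable lborel p"
    and bound: "\<And>u. norm (p u) \<le> B"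
    and hat: "integrable lborel (\<lambda>y. CLINT u|lborel. p u * iexp (y * u))"
  shows "(CLINT y|lborel. (CLINT u|lborel. p u * iexp (y * u)) * iexp (- (y * v))) = 2 * pi * p v"
proof -
  have [measurable]: "p \<in> borel_measurable borel"
    using borel_measurable_integrable[OF p] by simp
  define \<phi> where "\<phi> y = (CLINT u|lborel. p u * iexp (y * u)) * iexp (- (y * v))" for y
  have \<phi>: "integrable lborel \<phi>"
    using integrable_mult_iexp[OF hat, of "- v"] by (simp add: \<phi>_def[abs_def] mult_ac)
  have [measurable]: "\<phi> \<in> borel_measurable borel"
    using borel_measurable_integrable[OF \<phi>] by simp
  define e :: "nat \<Rightarrow> real" where "e k = 1 / Suc k" for k
  have e: "e k > 0" for k by (simp add: e_def)
  have e0: "e \<longlonglongrightarrow> 0"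
    unfolding e_def by (rule LIMSEQ_Suc) (rule lim_1_over_n)
  have g: "has_bochner_integral lborel (\<lambda>w::real. exp (- (w\<^sup>2 / 2))) (sqrt (2 * pi))"
  proof -
    have "has_bochner_integral lborel (\<lambda>w. sqrt (2 * pi) * std_normal_density w) (sqrt (2 * pi) * 1)"
      using std_normal_moment_even[of 0] by (intro has_bochner_integral_mult_right) auto
    then show ?thesis by (simp add: std_normal_density_def)
  qed
  have L1: "(\<lambda>k. CLINT y|lborel. std_normal_density (e k * y) *\<^sub>R \<phi> y)
      \<longlonglongrightarrow> (CLINT y|lborel. std_normal_density 0 *\<^sub>R \<phi> y)"
  proof (rule integral_dominated_convergence)
    show "integrable lborel (\<lambda>y. norm (\<phi> y))" using \<phi> by simp
    show "AE y in lborel. norm (std_normal_density (e k * y) *\<^sub>R \<phi> y) \<le> norm (\<phi> y)" for k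
    proof (rule AE_I2)
      fix y
      \<comment> \<open>The crude bound 1 makes \<open>norm (\<phi> y)\<close> itself a majorant,
        uniformly in \<open>k\<close>.\<close>
      have "std_normal_density (e k * y) \<le> 1"
      proof -
        have "exp (- (e k * y)\<^sup>2 / 2) \<le> 1" by simp
        moreover have "1 \<le> sqrt (2 * pi)" using pi_ge_two by simp
        ultimately have "exp (- (e k * y)\<^sup>2 / 2) \<le> sqrt (2 * pi)" by linarith
        then show ?thesis by (simp add: std_normal_density_def)
      qed
      then show "norm (std_normal_density (e k * y) *\<^sub>R \<phi> y) \<le> norm (\<phi> y)"
        by (simp add: normal_density_nonneg mult_left_le_one_le)
    qed
    show "AE y in lborel. (\<lambda>k. std_normal_density (e k * y) *\<^sub>R \<phi> y) \<longlonglongrightarrow> std_normal_density 0 *\<^sub>R \<phi> y"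
    proof (rule AE_I2)
      fix y
      have "(\<lambda>k. (1 / sqrt (2 * pi) * exp (- (e k * y)\<^sup>2 / 2)) *\<^sub>R \<phi> y)
          \<longlonglongrightarrow> (1 / sqrt (2 * pi) * exp (- (0 * y)\<^sup>2 / 2)) *\<^sub>R \<phi> y"
        by (intro tendsto_intros e0) simp
      then show "(\<lambda>k. std_normal_density (e k * y) *\<^sub>R \<phi> y) \<longlonglongrightarrow> std_normal_density 0 *\<^sub>R \<phi> y"
        by (simp add: std_normal_density_def)
    qed
  qed (simp_all add: normal_density_def)
  have L2: "(\<lambda>k. CLINT w|lborel. exp (- (w\<^sup>2 / 2)) *\<^sub>R p (v + e k * w))
      \<longlonglongrightarrow> (CLINT w|lborel. exp (- (w\<^sup>2 / 2)) *\<^sub>R p v)"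
  proof (rule integral_dominated_convergence)
    show "integrable lborel (\<lambda>w::real. exp (- (w\<^sup>2 / 2)) * B)"
      using g by (auto simp: has_bochner_integral_iff)
    show "AE w in lborel. (\<lambda>k. exp (- (w\<^sup>2 / 2)) *\<^sub>R p (v + e k * w)) \<longlonglongrightarrow> exp (- (w\<^sup>2 / 2)) *\<^sub>R p v"
    proof (rule AE_I2)
      fix w
      have "(\<lambda>k. v + e k * w) \<longlonglongrightarrow> v + 0 * w" by (intro tendsto_intros e0)
      moreover have "isCont p v" using cont by (simp add: continuous_on_eq_continuous_at)
      ultimately have "(\<lambda>k. p (v + e k * w)) \<longlonglongrightarrow> p v"
        by (intro isCont_tendsto_compose[where g = p]) auto
      then show "(\<lambda>k. exp (- (w\<^sup>2 / 2)) *\<^sub>R p (v + e k * w)) \<longlonglongrightarrow> exp (- (w\<^sup>2 / 2)) *\<^sub>R p v"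
        by (intro tendsto_intros)
    qed
  qed (simp_all add: bound mult_left_mono)
  have "(CLINT y|lborel. std_normal_density 0 *\<^sub>R \<phi> y) = (CLINT w|lborel. exp (- (w\<^sup>2 / 2)) *\<^sub>R p v)"
    using L1 unfolding \<phi>_def fourier_gauss_regularised[OF p e]
    by (rule LIMSEQ_unique[OF _ L2])
  also have "\<dots> = sqrt (2 * pi) *\<^sub>R p v"
    using has_bochner_integral_scaleR_left[of "p v", OF g]
    by (rule has_bochner_integral_integral_eq)
  finally have "(1 / sqrt (2 * pi)) *\<^sub>R (CLINT y|lborel. \<phi> y) = sqrt (2 * pi) *\<^sub>R p v"
    by (simp add: std_normal_density_def)
  then have "sqrt (2 * pi) *\<^sub>R (1 / sqrt (2 * pi)) *\<^sub>R (CLINT y|lborel. \<phi> y)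
      = sqrt (2 * pi) *\<^sub>R sqrt (2 * pi) *\<^sub>R p v" by simp
  then have "(CLINT y|lborel. \<phi> y) = (2 * pi) *\<^sub>R p v"
    by (simp del: real_sqrt_mult)
  then show ?thesis by (simp add: \<phi>_def scaleR_conv_of_real)
qed

subsection \<open>The cosine transform of a Gaussian monomial\<close>

lemma Gamma_real_plus1: "x > 0 \<Longrightarrow> Gamma (x + 1) = x * Gamma x" for x :: real
  by (rule Gamma_plus1) (auto elim!: nonpos_Ints_cases)

text \<open>A form of the duplication formula. It links the \<open>Gamma (1/2 + k)\<close> in the
  hypergeometric series to the \<open>fact (2 * k)\<close> in the cosine series.\<close>

lemma fact_double_Gamma:
  "fact (2 * k) = 4 ^ k * fact k * Gamma (1/2 + real k) / Gamma (1/2)"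
proof (induction k)
  case (Suc k)
  have G: "Gamma (1/2 + real (Suc k)) = (1/2 + real k) * Gamma (1/2 + real k)"
    using Gamma_real_plus1[of "1/2 + real k"] by (simp add: add_ac)
  have "fact (2 * Suc k) = 4 * (1/2 + real k) * real (Suc k) * fact (2 * k)"
    by (simp add: algebra_simps)
  then show ?case unfolding Suc G by simp
qed (simp add: Gamma_one_half_real)

text \<open>Even and odd exponents come from two different closed forms; the Gamma form unites them,
  so the later term-by-term integration needs no split by parity.\<close>

lemma gaussian_moment_pos_Gamma:
  "has_bochner_integral lborel (\<lambda>u::real. indicator {0..} u *\<^sub>R (exp (- u\<^sup>2) * u ^ m)) (Gamma ((real m + 1) / 2) / 2)"
proof (cases "even m")
  case True
  then obtain k where m: "m = 2 * k" by auto
  have "sqrt pi * (fact (2 * k) / (2 ^ (2 * k) * fact k)) = Gamma (real k + 1 / 2)"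
    unfolding fact_double_Gamma by (simp add: Gamma_one_half_real power_mult add_ac)
  then have "sqrt pi / 2 * (fact (2 * k) / (2 ^ (2 * k) * fact k)) = Gamma ((real m + 1) / 2) / 2"
    by (simp add: m add_divide_distrib)
  then show ?thesis using gaussian_moment_even_pos[of k] by (simp only: m)
next
  case False
  then obtain k where m: "m = 2 * k + 1" by (auto elim: oddE)
  have "Gamma ((real m + 1) / 2) = fact k"
    using Gamma_fact[of k, where 'a=real] by (simp add: m add_divide_distrib)
  then show ?thesis using gaussian_moment_odd_pos[of k] by (simp only: m)
qed

text \<open>The right side is a cosine coefficient times a ratio of Gaussian moments. The 4 in the
  argument is what cancels the \<open>4 ^ k\<close> of the duplication formula.\<close>

lemma hyp1F1_half_term:
  assumes "a > 0"
  shows "Gamma (a + real k) * Gamma (1/2) / (Gamma a * Gamma (1/2 + real k)) * ((- (y\<^sup>2) / 4) ^ k / fact k)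
    = (-1) ^ k * y ^ (2 * k) / fact (2 * k) * (Gamma (a + real k) / Gamma a)"
proof -
  have "Gamma (1/2 + real k) \<noteq> 0" by (rule less_imp_neq[symmetric]) (simp add: Gamma_real_pos)
  moreover have "(- (y\<^sup>2) / 4) ^ k = (-1) ^ k * y ^ (2 * k) / 4 ^ k"
    by (metis divide_minus_left mult_minus1 power_divide power_minus power_mult)
  ultimately show ?thesis
    unfolding fact_double_Gamma by (simp add: Gamma_one_half_real mult_ac)
qed

text \<open>Up to a factor 2, the summands are the integrals of the absolute values of the terms of
  the cosine series; their summability licenses exchanging sum and integral.\<close>

lemma summable_gaussian_cos_moments:
  assumes a: "a > 0"
  shows "summable (\<lambda>k. y ^ (2 * k) / fact (2 * k) * Gamma (a + real k))"
proof -
  define f where "f k = y ^ (2 * k) / fact (2 * k) * Gamma (a + real k)" for k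
  \<comment> \<open>Since \<open>a + k \<le> (a + 1) * (1 + k)\<close>, this \<open>N\<close> makes
    the numerator of the ratio at most \<open>k * (1 + k)\<close> for \<open>k \<ge> N\<close>,
    which is less than half of the denominator \<open>(2 * k + 1) * (2 * k + 2)\<close>.\<close>
  obtain N :: nat where N: "real N > y\<^sup>2 * (a + 1)" using reals_Archimedean2 by blast
  have "norm (f (Suc k)) \<le> 1/2 * norm (f k)" if "k \<ge> N" for k
  proof -
    have "Gamma (a + real (Suc k)) = (a + real k) * Gamma (a + real k)"
      using Gamma_real_plus1[of "a + real k"] a by (simp add: add_ac)
    then have "f (Suc k) = f k * (y\<^sup>2 * (a + real k) / ((2 * real k + 1) * (2 * real k + 2)))"
      by (simp add: f_def power2_eq_square field_simps)
    moreover have "\<bar>y\<^sup>2 * (a + real k) / ((2 * real k + 1) * (2 * real k + 2))\<bar> \<le> 1 / 2"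
    proof -
      have "y\<^sup>2 * (a + real k) \<le> y\<^sup>2 * (a + 1) * (1 + real k)"
        unfolding mult.assoc using a by (intro mult_left_mono) (auto simp: algebra_simps)
      also have "\<dots> \<le> real k * (1 + real k)"
        using N that by (intro mult_right_mono) auto
      finally have "y\<^sup>2 * (a + real k) \<le> real k * (1 + real k)" .
      moreover have "0 \<le> y\<^sup>2 * (a + real k)" using a by simp
      ultimately show ?thesis by (simp add: field_simps)
    qed
    ultimately show ?thesis
      using mult_right_mono[of "\<bar>y\<^sup>2 * (a + real k) / ((2 * real k + 1) * (2 * real k + 2))\<bar>" "1/2" "norm (f k)"]
      by (simp add: abs_mult mult.commute)
  qed
  then have "summable f" by (intro summable_ratio_test[of "1/2"]) auto
  then show ?thesis by (simp add: f_def[abs_def])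
qed

text \<open>Expand \<open>cos (y * u)\<close> in its power series and integrate each term with the
  moment formula; absolute summability allows the exchange, and the resulting series is
  hypergeometric term by term.\<close>

lemma gaussian_cos_transform:
  fixes y :: real
  shows "has_bochner_integral lborel (\<lambda>u::real. indicator {0..} u *\<^sub>R (exp (- u\<^sup>2) * u ^ n * cos (y * u)))
    (Gamma ((real n + 1) / 2) / 2 * hyp1F1 ((real n + 1) / 2) (1/2) (- (y\<^sup>2) / 4))"
proof -
  define a where "a = (real n + 1) / 2"
  have a: "a > 0" by (simp add: a_def)
  then have Ga: "Gamma a > 0" by (rule Gamma_real_pos)
  define h where "h k u = ((-1) ^ k * y ^ (2 * k) / fact (2 * k)) * (indicator {0..} u *\<^sub>R (exp (- u\<^sup>2) * u ^ (n + 2 * k)))"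
    for k :: nat and u :: real
  have mom: "has_bochner_integral lborel (\<lambda>u::real. indicator {0..} u *\<^sub>R (exp (- u\<^sup>2) * u ^ (n + 2 * k))) (Gamma (a + real k) / 2)" for k
    using gaussian_moment_pos_Gamma[of "n + 2 * k"] by (simp add: a_def field_simps)
  have hb: "has_bochner_integral lborel (h k) (((-1) ^ k * y ^ (2 * k) / fact (2 * k)) * (Gamma (a + real k) / 2))" for k
    unfolding h_def using mom by (intro has_bochner_integral_mult_right) auto
  have nh: "norm (h k u) = (y ^ (2 * k) / fact (2 * k)) * (indicator {0..} u *\<^sub>R (exp (- u\<^sup>2) * u ^ (n + 2 * k)))" for k u
    by (simp add: h_def abs_mult power_abs indicator_def power_even_abs)
  have hnb: "has_bochner_integral lborel (\<lambda>u. norm (h k u)) ((y ^ (2 * k) / fact (2 * k)) * (Gamma (a + real k) / 2))" for k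
    unfolding nh using mom by (intro has_bochner_integral_mult_right) auto
  have cs: "(\<lambda>k. (-1) ^ k * y ^ (2 * k) / fact (2 * k) * u ^ (2 * k)) sums cos (y * u)" for u
    using cos_paired[of "y * u"] by (simp add: power_mult_distrib mult_ac)
  have hs: "(\<lambda>k. h k u) sums (indicator {0..} u *\<^sub>R (exp (- u\<^sup>2) * u ^ n * cos (y * u)))" for u
    using sums_mult[OF cs[of u], of "indicator {0..} u * (exp (- u\<^sup>2) * u ^ n)"]
    by (simp add: h_def power_add mult_ac)
  have hsn: "summable (\<lambda>k. norm (h k u))" for u
  proof -
    \<comment> \<open>The moment series with \<open>a = 1\<close> serves as majorant, because
      \<open>Gamma (1 + k)\<close> is \<open>fact k\<close>, hence at least 1.\<close>
    have "summable (\<lambda>k. \<bar>y * u\<bar> ^ (2 * k) / fact (2 * k))"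
    proof (rule summable_comparison_test')
      show "summable (\<lambda>k. \<bar>y * u\<bar> ^ (2 * k) / fact (2 * k) * Gamma (1 + real k))"
        by (rule summable_gaussian_cos_moments) simp
      show "norm (\<bar>y * u\<bar> ^ (2 * k) / fact (2 * k)) \<le> \<bar>y * u\<bar> ^ (2 * k) / fact (2 * k) * Gamma (1 + real k)" for k
        using mult_left_mono[OF fact_ge_1[of k, where 'a=real], of "\<bar>y * u\<bar> ^ (2 * k) / fact (2 * k)"]
        by (simp add: Gamma_fact)
    qed
    then have "summable (\<lambda>k. (indicator {0..} u * (exp (- u\<^sup>2) * u ^ n)) * (\<bar>y * u\<bar> ^ (2 * k) / fact (2 * k)))"
      by (rule summable_mult)
    moreover have "norm (h k u) = (indicator {0..} u * (exp (- u\<^sup>2) * u ^ n)) * (\<bar>y * u\<bar> ^ (2 * k) / fact (2 * k))" for k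
      unfolding nh by (simp add: power_add power_mult_distrib power_even_abs)
    ultimately show ?thesis by (simp only:)
  qed
  have S: "summable (\<lambda>k. LINT u|lborel. norm (h k u))"
    unfolding has_bochner_integral_integral_eq[OF hnb]
    using summable_divide[OF summable_gaussian_cos_moments[OF a, of y], of 2] by simp
  have ih: "integrable lborel (h k)" for k using hb by (auto simp: has_bochner_integral_iff)
  have "(\<lambda>k. integral\<^sup>L lborel (h k)) sums (LINT u|lborel. (\<Sum>k. h k u))"
    by (rule sums_integral[OF ih _ S]) (rule AE_I2, rule hsn)
  moreover have "integral\<^sup>L lborel (h k) = Gamma a / 2 *
      (Gamma (a + real k) * Gamma (1/2) / (Gamma a * Gamma (1/2 + real k)) * ((- (y\<^sup>2) / 4) ^ k / fact k))" for k
    unfolding has_bochner_integral_integral_eq[OF hb] hyp1F1_half_term[OF a] using Ga by simp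
  \<comment> \<open>The limit is written as a multiple of \<open>Gamma a / 2\<close> so that this
    constant can be cancelled from the series by \<open>sums_mult_iff\<close>.\<close>
  ultimately have "(\<lambda>k. Gamma a / 2 *
      (Gamma (a + real k) * Gamma (1/2) / (Gamma a * Gamma (1/2 + real k)) * ((- (y\<^sup>2) / 4) ^ k / fact k)))
      sums (Gamma a / 2 * (2 / Gamma a * (LINT u|lborel. (\<Sum>k. h k u))))"
    using Ga by simp
  then have "hyp1F1 a (1/2) (- (y\<^sup>2) / 4) = 2 / Gamma a * (LINT u|lborel. (\<Sum>k. h k u))"
    unfolding hyp1F1_def using Ga by (subst (asm) sums_mult_iff) (auto intro: sums_unique[symmetric])
  then have "(LINT u|lborel. (\<Sum>k. h k u)) = Gamma a / 2 * hyp1F1 a (1/2) (- (y\<^sup>2) / 4)"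
    using Ga by simp
  moreover have "integrable lborel (\<lambda>u. \<Sum>k. h k u)"
    by (rule integrable_suminf[OF ih _ S]) (rule AE_I2, rule hsn)
  moreover have "(\<Sum>k. h k u) = indicator {0..} u *\<^sub>R (exp (- u\<^sup>2) * u ^ n * cos (y * u))" for u
    using hs by (rule sums_unique[symmetric])
  ultimately show ?thesis by (simp add: has_bochner_integral_iff a_def)
qed

subsection \<open>Decay of the cosine transform\<close>

text \<open>The power is taken without absolute value: on the half-line this agrees with the
  density, and it is smooth across 0, so derivatives at 0 are two-sided.\<close>

definition gauss_monom :: "nat \<Rightarrow> real \<Rightarrow> real" where "gauss_monom m u = exp (- u\<^sup>2) * u ^ m"

text \<open>The open half-line is the form that \<open>einterval 0 \<infinity>\<close> takes in the
  fundamental theorem of calculus used for the decay estimate.\<close>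

lemma integrable_gauss_monom: "integrable lborel (\<lambda>u. indicator {0<..} u *\<^sub>R gauss_monom m u)"
proof -
  have "integrable lborel (\<lambda>u. indicator {0..} u *\<^sub>R gauss_monom m u)"
    using gaussian_moment_pos_Gamma[of m] by (simp add: has_bochner_integral_iff gauss_monom_def)
  then have "set_integrable lborel {0..} (gauss_monom m)" by (simp add: set_integrable_def)
  then have "set_integrable lborel {0<..} (gauss_monom m)" by (rule set_integrable_subset) auto
  then show ?thesis by (simp add: set_integrable_def)
qed

lemma gauss_monom_tendsto_0: "(gauss_monom m \<longlongrightarrow> 0) at_top"
  unfolding gauss_monom_def by real_asymp

text \<open>Truncation of \<open>m - 1\<close> at \<open>m = 0\<close> is harmless, as the
  coefficient \<open>real m\<close> vanishes there.\<close>

lemma gauss_monom_deriv: "(gauss_monom m has_real_derivative (real m * gauss_monom (m - 1) u - 2 * gauss_monom (m + 1) u)) (at u)"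
  unfolding gauss_monom_def by (auto intro!: derivative_eq_intros simp: algebra_simps)

lemma continuous_gauss_monom [continuous_intros]: "isCont (gauss_monom m) u"
  unfolding gauss_monom_def by (intro continuous_intros)

lemma gaussian_cos_decay:
  "\<exists>K. \<forall>y. y \<noteq> 0 \<longrightarrow> \<bar>LINT u|lborel. indicator {0<..} u *\<^sub>R (gauss_monom n u * cos (y * u))\<bar> \<le> K / y\<^sup>2"
proof -
  \<comment> \<open>\<open>d1\<close> and \<open>d2\<close> are the first two derivatives of
    \<open>gauss_monom n\<close>, with exponents left in the form that
    \<open>gauss_monom_deriv\<close> yields.\<close>
  define d1 where "d1 u = real n * gauss_monom (n - 1) u - 2 * gauss_monom (n + 1) u" for u
  define d2 where "d2 u = real n * (real (n - 1) * gauss_monom (n - 1 - 1) u - 2 * gauss_monom (n - 1 + 1) u)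
      - 2 * (real (n + 1) * gauss_monom (n + 1 - 1) u - 2 * gauss_monom (n + 1 + 1) u)" for u
  have D1: "(gauss_monom n has_real_derivative d1 u) (at u)" for u
    unfolding d1_def by (rule gauss_monom_deriv)
  have D2: "(d1 has_real_derivative d2 u) (at u)" for u
    unfolding d1_def d2_def by (intro DERIV_diff DERIV_cmult gauss_monom_deriv)
  have d1_lim: "(d1 \<longlongrightarrow> 0) at_top"
    unfolding d1_def using tendsto_diff[OF tendsto_mult_left[OF gauss_monom_tendsto_0] tendsto_mult_left[OF gauss_monom_tendsto_0]]
    by simp
  have d2_int: "integrable lborel (\<lambda>u. indicator {0<..} u *\<^sub>R d2 u)"
    unfolding d2_def
    by (simp only: scaleR_diff_right right_diff_distrib mult_scaleR_right[symmetric])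
       (intro Bochner_Integration.integrable_diff integrable_mult_right integrable_gauss_monom)
  have d2_cont: "isCont d2 u" for u
    unfolding d2_def by (intro continuous_intros)
  have bounded_mult: "integrable lborel (\<lambda>u. indicator {0<..} u *\<^sub>R (f u * cos (y * u)))"
    if "integrable lborel (\<lambda>u. indicator {0<..} u *\<^sub>R f u)" for f :: "real \<Rightarrow> real" and y
  proof (rule Bochner_Integration.integrable_bound[OF that])
    have "(\<lambda>u. (indicator {0<..} u *\<^sub>R f u) * cos (y * u)) \<in> borel_measurable lborel"
      using borel_measurable_integrable[OF that] by measurable
    then show "(\<lambda>u. indicator {0<..} u *\<^sub>R (f u * cos (y * u))) \<in> borel_measurable lborel"
      by (simp add: mult_ac)
    show "AE u in lborel. norm (indicator {0<..} u *\<^sub>R (f u * cos (y * u))) \<le> norm (indicator {0<..} u *\<^sub>R f u)"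
      by (auto simp: abs_mult mult_left_le indicator_def)
  qed
  \<comment> \<open>The first summand bounds the boundary term at 0, the second the integral left
    after two integrations by parts; neither depends on \<open>y\<close>.\<close>
  define K where "K = \<bar>d1 0\<bar> + (LINT u|lborel. \<bar>indicator {0<..} u *\<^sub>R d2 u\<bar>)"
  have "\<bar>LINT u|lborel. indicator {0<..} u *\<^sub>R (gauss_monom n u * cos (y * u))\<bar> \<le> K / y\<^sup>2" if y: "y \<noteq> 0" for y
  proof -
    \<comment> \<open>\<open>H\<close> collects the boundary terms of the two integrations by parts.\<close>
    define H where "H u = gauss_monom n u * sin (y * u) / y + d1 u * cos (y * u) / y\<^sup>2" for u
    define h where "h u = gauss_monom n u * cos (y * u) + d2 u * cos (y * u) / y\<^sup>2" for u
    have h_int: "set_integrable lborel {0<..} h"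
      using Bochner_Integration.integrable_add[OF bounded_mult[OF integrable_gauss_monom[of n], of y]
          integrable_divide[OF bounded_mult[OF d2_int, of y], of "y\<^sup>2"]]
      by (simp add: set_integrable_def h_def algebra_simps add_divide_distrib)
    \<comment> \<open>The two terms \<open>d1 u * sin (y * u) / y\<close> arising from the product
      rule cancel.\<close>
    have HD: "(H has_real_derivative h u) (at u)" for u
      unfolding H_def h_def using y
      by (auto intro!: derivative_eq_intros D1 D2 simp: field_simps power2_eq_square)
    have "(LBINT u=0..\<infinity>. h u) = 0 - H 0"
    proof (rule interval_integral_FTC_integrable)
      show "(H has_vector_derivative h u) (at u)" for u
        using HD by (simp add: has_real_derivative_iff_has_vector_derivative)
      show "isCont h u" for u
        unfolding h_def by (intro continuous_intros d2_cont) (use y in auto)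
      show "set_integrable lborel (einterval 0 \<infinity>) h"
        using h_int by (simp add: zero_ereal_def)
      have "isCont H 0" using HD by (rule DERIV_isCont)
      then have "(H \<longlongrightarrow> H 0) (at_right 0)"
        by (auto simp: isCont_def intro: tendsto_mono at_le)
      then show "((H \<circ> real_of_ereal) \<longlongrightarrow> H 0) (at_right 0)"
        unfolding zero_ereal_def ereal_tendsto_simps .
      have "((\<lambda>u. gauss_monom n u * sin (y * u)) \<longlongrightarrow> 0) at_top"
        by (rule tendsto_0_le[OF gauss_monom_tendsto_0[of n], where K = 1])
           (auto simp: abs_mult mult_left_le intro!: always_eventually)
      moreover have "((\<lambda>u. d1 u * cos (y * u)) \<longlongrightarrow> 0) at_top"
        by (rule tendsto_0_le[OF d1_lim, where K = 1])
           (auto simp: abs_mult mult_left_le intro!: always_eventually)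
      ultimately have "(H \<longlongrightarrow> 0 / y + 0 / y\<^sup>2) at_top"
        unfolding H_def using y by (intro tendsto_intros) auto
      then show "((H \<circ> real_of_ereal) \<longlongrightarrow> 0) (at_left \<infinity>)"
        unfolding ereal_tendsto_simps by simp
    qed simp_all
    \<comment> \<open>The sine term of \<open>H\<close> vanishes at 0, so no contribution of order
      \<open>1 / y\<close> survives.\<close>
    then have "(LINT u|lborel. indicator {0<..} u *\<^sub>R h u) = - (d1 0 / y\<^sup>2)"
      unfolding zero_ereal_def interval_integral_to_infinity_eq
      by (simp add: set_lebesgue_integral_def H_def)
    moreover have "(LINT u|lborel. indicator {0<..} u *\<^sub>R h u)
       = (LINT u|lborel. indicator {0<..} u *\<^sub>R (gauss_monom n u * cos (y * u)))
        + (LINT u|lborel. indicator {0<..} u *\<^sub>R (d2 u * cos (y * u))) / y\<^sup>2"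
      using Bochner_Integration.integral_add[OF bounded_mult[OF integrable_gauss_monom[of n], of y]
          integrable_divide[OF bounded_mult[OF d2_int, of y], of "y\<^sup>2"]]
      by (simp add: h_def algebra_simps add_divide_distrib)
    moreover have "\<bar>LINT u|lborel. indicator {0<..} u *\<^sub>R (d2 u * cos (y * u))\<bar>
        \<le> (LINT u|lborel. \<bar>indicator {0<..} u *\<^sub>R d2 u\<bar>)"
    proof -
      have "\<bar>LINT u|lborel. indicator {0<..} u *\<^sub>R (d2 u * cos (y * u))\<bar>
         \<le> (LINT u|lborel. \<bar>indicator {0<..} u *\<^sub>R (d2 u * cos (y * u))\<bar>)"
        by (rule integral_abs_bound)
      also have "\<dots> \<le> (LINT u|lborel. \<bar>indicator {0<..} u *\<^sub>R d2 u\<bar>)"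
        by (intro integral_mono integrable_abs bounded_mult d2_int)
           (auto simp: abs_mult mult_left_le indicator_def)
      finally show ?thesis .
    qed
    ultimately have eq: "(LINT u|lborel. indicator {0<..} u *\<^sub>R (gauss_monom n u * cos (y * u)))
        = - ((d1 0 + (LINT u|lborel. indicator {0<..} u *\<^sub>R (d2 u * cos (y * u)))) / y\<^sup>2)"
      and le: "\<bar>d1 0 + (LINT u|lborel. indicator {0<..} u *\<^sub>R (d2 u * cos (y * u)))\<bar> \<le> K"
      by (simp_all add: K_def add_divide_distrib)
    show ?thesis
      unfolding eq abs_minus_cancel abs_divide using le by (simp add: divide_right_mono)
  qed
  then show ?thesis by blast
qed

subsection \<open>The Fourier transform of the hypergeometric function\<close>

text \<open>The weight is even, so the cosine part doubles the half-line integral and the sine part,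
  being odd, integrates to 0.\<close>

lemma has_bochner_integral_gaussian_char:
  "has_bochner_integral lborel (\<lambda>u. complex_of_real (exp (- u\<^sup>2) * \<bar>u\<bar> ^ n) * iexp (y * u))
     (Gamma ((real n + 1) / 2) * hyp1F1 ((real n + 1) / 2) (1/2) (- (y\<^sup>2) / 4))"
proof -
  let ?g = "\<lambda>u::real. exp (- u\<^sup>2) * \<bar>u\<bar> ^ n"
  define I where "I = Gamma ((real n + 1) / 2) * hyp1F1 ((real n + 1) / 2) (1/2) (- (y\<^sup>2) / 4)"
  have "has_bochner_integral lborel (\<lambda>u. indicator {0..} u *\<^sub>R (?g u * cos (y * u))) (I / 2)"
    using gaussian_cos_transform[of n y]
    by (rule has_bochner_integral_cong[THEN iffD1, rotated -1]) (auto simp: I_def indicator_def)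
  from has_bochner_integral_even_function[OF this]
  have re: "has_bochner_integral lborel (\<lambda>u. ?g u * cos (y * u)) I" by simp
  have "integrable lborel (\<lambda>u. indicator {0..} u *\<^sub>R (?g u * sin (y * u)))"
  proof (rule Bochner_Integration.integrable_bound)
    show "integrable lborel (\<lambda>u::real. indicator {0..} u *\<^sub>R (exp (- u\<^sup>2) * u ^ n))"
      using gaussian_moment_pos_Gamma by (simp add: has_bochner_integral_iff)
  qed (auto simp: indicator_def abs_mult power_abs mult_left_le)
  from has_bochner_integral_odd_function[OF has_bochner_integral_integrable[OF this]]
  have im: "has_bochner_integral lborel (\<lambda>u. ?g u * sin (y * u)) 0" by simp
  have "has_bochner_integral lborel
      (\<lambda>u. complex_of_real (?g u * cos (y * u)) + \<i> * complex_of_real (?g u * sin (y * u)))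
      (complex_of_real I + \<i> * complex_of_real 0)"
    by (intro has_bochner_integral_add has_bochner_integral_mult_right has_bochner_integral_of_real re im)
  moreover have "complex_of_real (?g u * cos (y * u)) + \<i> * complex_of_real (?g u * sin (y * u))
      = complex_of_real (?g u) * iexp (y * u)" for u
    by (simp only: cis_conv_exp[symmetric]) (simp add: complex_eq_iff)
  ultimately show ?thesis by (simp only: I_def of_real_0 mult_zero_right add_0_right)
qed

text \<open>Up to a constant the function is the cosine transform \<open>J\<close>, bounded by
  \<open>J 0\<close> everywhere and by \<open>K / y\<^sup>2\<close> away from 0. Together these give
  the integrable majorant \<open>(J 0 + K) / (1 + y\<^sup>2)\<close>.\<close>

lemma integrable_hyp1F1_half:
  "integrable lborel (\<lambda>y. hyp1F1 ((real n + 1) / 2) (1/2) (- (y\<^sup>2) / 4))"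
proof -
  define a where "a = (real n + 1) / 2"
  have Ga: "Gamma a > 0" by (simp add: a_def Gamma_real_pos)
  define J where "J y = (LINT u|lborel. indicator {0<..} u *\<^sub>R (gauss_monom n u * cos (y * u)))" for y
  \<comment> \<open>Measurability in \<open>y\<close> is obtained from the integral representation
    instead of the series.\<close>
  have meas[measurable]: "J \<in> borel_measurable borel"
    unfolding J_def gauss_monom_def by measurable
  have J: "J y = Gamma a / 2 * hyp1F1 a (1/2) (- (y\<^sup>2) / 4)" for y
  proof -
    have "J y = (LINT u|lborel. indicator {0..} u *\<^sub>R (exp (- u\<^sup>2) * u ^ n * cos (y * u)))"
      unfolding J_def gauss_monom_def using AE_lborel_singleton[of "0::real"]
      by (intro Bochner_Integration.integral_cong_AE) (auto simp: indicator_def elim!: eventually_mono)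
    then show ?thesis
      using has_bochner_integral_integral_eq[OF gaussian_cos_transform[of n y]] by (simp add: a_def)
  qed
  obtain K where K: "\<bar>J y\<bar> \<le> K / y\<^sup>2" if "y \<noteq> 0" for y
    using gaussian_cos_decay[of n] unfolding J_def by blast
  have J0: "\<bar>J y\<bar> \<le> J 0" for y
  proof -
    have i: "integrable lborel (\<lambda>u. indicator {0<..} u *\<^sub>R gauss_monom n u)" by (rule integrable_gauss_monom)
    have "\<bar>J y\<bar> \<le> (LINT u|lborel. \<bar>indicator {0<..} u *\<^sub>R (gauss_monom n u * cos (y * u))\<bar>)"
      unfolding J_def by (rule integral_abs_bound)
    also have "\<dots> \<le> (LINT u|lborel. indicator {0<..} u *\<^sub>R gauss_monom n u)"
    proof (rule integral_mono'[OF i])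
      show "\<bar>indicator {0<..} u *\<^sub>R (gauss_monom n u * cos (y * u))\<bar> \<le> indicator {0<..} u *\<^sub>R gauss_monom n u" for u
        by (auto simp: indicator_def abs_mult gauss_monom_def power_abs mult_left_le)
    qed (auto simp: indicator_def gauss_monom_def)
    finally show ?thesis by (simp add: J_def)
  qed
  have "integrable lborel (\<lambda>y::real. (J 0 + K) * inverse (1 + y\<^sup>2))"
    using integrable_inverse_1_plus_square by (simp add: set_integrable_def)
  then have "integrable lborel J"
  proof (rule Bochner_Integration.integrable_bound)
    have "\<bar>J y\<bar> \<le> \<bar>(J 0 + K) * inverse (1 + y\<^sup>2)\<bar>" for y
    proof -
      have "\<bar>J y\<bar> * y\<^sup>2 \<le> K"
      proof (cases "y = 0")
        case True
        \<comment> \<open>The decay bound says nothing at \<open>y = 0\<close>; there only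
          \<open>K \<ge> 0\<close> is needed, which follows from the bound at 1.\<close>
        have "0 \<le> \<bar>J 1\<bar>" by simp
        also have "\<dots> \<le> K" using K[of 1] by simp
        finally show ?thesis using True by simp
      qed (use K[of y] in \<open>simp add: field_simps\<close>)
      then have "\<bar>J y\<bar> * (1 + y\<^sup>2) \<le> J 0 + K" using J0[of y] by (simp add: algebra_simps)
      moreover have "0 < 1 + y\<^sup>2" by (simp add: add_pos_nonneg)
      ultimately have "\<bar>J y\<bar> \<le> (J 0 + K) * inverse (1 + y\<^sup>2)"
        by (simp add: field_simps)
      then show ?thesis by linarith
    qed
    then show "AE y in lborel. norm (J y) \<le> norm ((J 0 + K) * inverse (1 + y\<^sup>2))" by simp
  qed simp
  then have "integrable lborel (\<lambda>y. 2 / Gamma a * J y)" by simp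
  moreover have "2 / Gamma a * J y = hyp1F1 a (1/2) (- (y\<^sup>2) / 4)" for y
    using Ga by (simp add: J)
  ultimately show ?thesis by (simp only: a_def)
qed

lemma fourier_hyp1F1_half:
  "(CLINT y|lborel. complex_of_real (hyp1F1 ((real n + 1) / 2) (1/2) (- (y\<^sup>2) / 4)) * iexp (- (y * v)))
     = complex_of_real (2 * pi * exp (- v\<^sup>2) * \<bar>v\<bar> ^ n / Gamma ((real n + 1) / 2))"
proof -
  define a where "a = (real n + 1) / 2"
  have Ga: "Gamma a > 0" by (simp add: a_def Gamma_real_pos)
  define p where "p u = complex_of_real (exp (- u\<^sup>2) * \<bar>u\<bar> ^ n)" for u :: real
  define \<psi> where "\<psi> y = hyp1F1 a (1/2) (- (y\<^sup>2) / 4)" for y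
  have ch: "has_bochner_integral lborel (\<lambda>u. p u * iexp (y * u)) (complex_of_real (Gamma a * \<psi> y))" for y
    unfolding p_def \<psi>_def a_def by (rule has_bochner_integral_gaussian_char)
  have hat: "(CLINT u|lborel. p u * iexp (y * u)) = complex_of_real (Gamma a * \<psi> y)" for y
    by (rule has_bochner_integral_integral_eq[OF ch])
  have "(CLINT y|lborel. (CLINT u|lborel. p u * iexp (y * u)) * iexp (- (y * v))) = 2 * pi * p v"
  proof (rule fourier_inversion_continuous)
    show "continuous_on UNIV p" unfolding p_def by (intro continuous_intros)
    show "integrable lborel p" using ch[of 0] by (simp add: has_bochner_integral_iff)
    \<comment> \<open>Any uniform bound will do. This one comes from
      \<open>\<bar>u\<bar> \<le> exp \<bar>u\<bar>\<close> and
      \<open>n * \<bar>u\<bar> \<le> n\<^sup>2 + u\<^sup>2\<close>, whose last term the Gaussian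
      cancels.\<close>
    show "norm (p u) \<le> exp ((real n)\<^sup>2)" for u
    proof -
      have "\<bar>u\<bar> \<le> exp \<bar>u\<bar>" using exp_ge_add_one_self[of "\<bar>u\<bar>"] by linarith
      then have "\<bar>u\<bar> ^ n \<le> exp (real n * \<bar>u\<bar>)"
        by (simp add: exp_of_nat_mult power_mono)
      then have "exp (- u\<^sup>2) * \<bar>u\<bar> ^ n \<le> exp (- u\<^sup>2) * exp (real n * \<bar>u\<bar>)" by simp
      also have "\<dots> \<le> exp ((real n)\<^sup>2)"
      proof -
        have "real n * \<bar>u\<bar> \<le> (real n)\<^sup>2 + \<bar>u\<bar>\<^sup>2"
          using sum_squares_bound[of "real n" "\<bar>u\<bar>"] mult_nonneg_nonneg[of "real n" "\<bar>u\<bar>"] by linarith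
        then show ?thesis by (simp add: exp_add[symmetric])
      qed
      finally show ?thesis by (simp add: p_def norm_mult norm_power)
    qed
    show "integrable lborel (\<lambda>y. CLINT u|lborel. p u * iexp (y * u))"
      unfolding hat \<psi>_def a_def using integrable_hyp1F1_half[of n] by (intro integrable_of_real) simp
  qed
  then have "complex_of_real (Gamma a) * (CLINT y|lborel. complex_of_real (\<psi> y) * iexp (- (y * v))) = 2 * pi * p v"
    unfolding hat by (simp only: of_real_mult mult.assoc integral_mult_right_zero)
  then show ?thesis
    unfolding \<psi>_def a_def[symmetric] using Ga by (simp add: p_def field_simps)
qed

text \<open>The case \<open>v = 0\<close>, \<open>n = 0\<close> is where the convention in
  \<open>pow0\<close> matters: \<open>\<bar>0\<bar> ^ 0\<close> is 1, whereas
  \<open>0 powr 0\<close> is 0.\<close>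

lemma pow0_square: "pow0 (v\<^sup>2) (real n / 2) = \<bar>v\<bar> ^ n"
proof (cases "v = 0")
  case False
  then have "(v\<^sup>2) powr (real n / 2) = (\<bar>v\<bar> powr 2) powr (real n / 2)"
    by simp
  also have "\<dots> = \<bar>v\<bar> ^ n"
    using False by (subst powr_powr) (simp add: powr_realpow)
  finally show ?thesis using False by (simp add: pow0_def)
qed (auto simp: pow0_def)

theorem lemma2p6:
  fixes d :: nat and \<sigma> :: real
  assumes "d \<ge> 1" and "\<sigma> > 0"
  shows "integrable lborel (f_sigma d \<sigma>) \<and>
    (\<forall>\<omega>::real. fourier_transform (f_sigma d \<sigma>) \<omega> =
       complex_of_real
         (real d * pi * \<sigma> * exp (- 2 * pi\<^sup>2 * \<sigma>\<^sup>2 * \<omega>\<^sup>2)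
            * pow0 (2 * pi\<^sup>2 * \<sigma>\<^sup>2 * \<omega>\<^sup>2) ((real d - 1) / 2)
          / (sqrt 2 * Gamma ((real d + 2) / 2))))"
proof -
  obtain n where n: "d = Suc n" using assms(1) by (cases d) auto
  define a where "a = (real n + 1) / 2"
  have a: "a > 0" by (simp add: a_def)
  have Ga: "Gamma a > 0" using a by (rule Gamma_real_pos)
  \<comment> \<open>The functional equation of Gamma accounts for the factor \<open>d\<close> in the
    stated formula.\<close>
  have Gd: "Gamma ((real d + 2) / 2) = real d / 2 * Gamma a"
    using Gamma_real_plus1[OF a] by (simp add: a_def n field_simps)
  define \<psi> where "\<psi> y = hyp1F1 a (1/2) (- (y\<^sup>2) / 4)" for y
  \<comment> \<open>Chosen so that
    \<open>(c * x)\<^sup>2 / 4 = x\<^sup>2 / (2 * \<sigma>\<^sup>2)\<close>.\<close>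
  define c where "c = sqrt 2 / \<sigma>"
  have c: "c > 0" using assms by (simp add: c_def)
  have f: "f_sigma d \<sigma> x = \<psi> (0 + c * x)" for x
    using assms by (simp add: f_sigma_def \<psi>_def c_def a_def n power_divide power_mult_distrib add_ac)
  have "integrable lborel \<psi>"
    unfolding \<psi>_def[abs_def] a_def by (rule integrable_hyp1F1_half)
  then have "integrable lborel (f_sigma d \<sigma>)"
    unfolding f[abs_def] using c by (intro lborel_integrable_real_affine) auto
  moreover have "fourier_transform (f_sigma d \<sigma>) \<omega> =
       complex_of_real
         (real d * pi * \<sigma> * exp (- 2 * pi\<^sup>2 * \<sigma>\<^sup>2 * \<omega>\<^sup>2)
            * pow0 (2 * pi\<^sup>2 * \<sigma>\<^sup>2 * \<omega>\<^sup>2) ((real d - 1) / 2)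
          / (sqrt 2 * Gamma ((real d + 2) / 2)))" for \<omega>
  proof -
    \<comment> \<open>The frequency after rescaling: \<open>c * v = 2 * pi * \<omega>\<close>
      matches the phase, and \<open>v\<^sup>2\<close> is exactly the quantity in the exponent and in
      \<open>pow0\<close>.\<close>
    define v where "v = sqrt 2 * pi * \<sigma> * \<omega>"
    have v2: "2 * pi\<^sup>2 * \<sigma>\<^sup>2 * \<omega>\<^sup>2 = v\<^sup>2" by (simp add: v_def power_mult_distrib)
    have cv: "c * v = 2 * pi * \<omega>" using assms by (simp add: c_def v_def)
    have "fourier_transform (f_sigma d \<sigma>) \<omega>
        = (CLINT x|lborel. complex_of_real (\<psi> (0 + c * x)) * iexp (- ((0 + c * x) * v)))"
      unfolding fourier_transform_def f
    proof (intro Bochner_Integration.integral_cong refl)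
      fix x :: real
      have "(0 + c * x) * v = 2 * pi * x * \<omega>" using cv by (simp add: mult_ac)
      then show "complex_of_real (\<psi> (0 + c * x)) * exp (- 2 * complex_of_real pi * \<i> * complex_of_real x * complex_of_real \<omega>)
        = complex_of_real (\<psi> (0 + c * x)) * iexp (- ((0 + c * x) * v))"
        by (simp only:) (simp add: mult_ac)
    qed
    also have "\<dots> = (1 / c) *\<^sub>R (CLINT y|lborel. complex_of_real (\<psi> y) * iexp (- (y * v)))"
      using c lborel_integral_real_affine[of c "\<lambda>y. complex_of_real (\<psi> y) * iexp (- (y * v))" 0] by simp
    also have "\<dots> = complex_of_real (\<sigma> / sqrt 2 * (2 * pi * exp (- v\<^sup>2) * \<bar>v\<bar> ^ n / Gamma a))"
      unfolding \<psi>_def a_def fourier_hyp1F1_half by (simp add: c_def scaleR_conv_of_real)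
    also have "\<sigma> / sqrt 2 * (2 * pi * exp (- v\<^sup>2) * \<bar>v\<bar> ^ n / Gamma a)
       = real d * pi * \<sigma> * exp (- v\<^sup>2) * pow0 (v\<^sup>2) ((real d - 1) / 2) / (sqrt 2 * Gamma ((real d + 2) / 2))"
      unfolding Gd using pow0_square[of v n] Ga by (simp add: n)
    finally show ?thesis by (simp add: v2[symmetric])
  qed
  ultimately show ?thesis by blast
qed

end
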